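(* Let $G=SL(2,\mathbb{R})$. For all $g=h\exp(iX)K_{\mathbb{C}}\in\Xi$ with $h\in G$ and $X\in\Omega$, we have $$|a_{K_{\mathbb{C}}}(g)|\le\|h\|.$$
   Context: $G=SL(2,\mathbb{R})$, $G_{\mathbb{C}}=SL(2,\mathbb{C})$, $K_{\mathbb{C}}=SO(2,\mathbb{C})$, $K=SO(2,\mathbb{R})$, $\mathfrak{a}=\{\mathrm{diag}(t,-t): t\in\mathbb{R}\}$, $A=\exp(\mathfrak{a})$, $A_{\mathbb{C}}=\{\mathrm{diag}(z,z^{-1}): z\in\mathbb{C}^*\}$, $\Omega=\{\mathrm{diag}(t,-t): |t|<\pi/4\}$ (that is, $\Omega=\{X\in\mathfrak{a}:|\alpha(X)|<\pi/2\}$ for the roots $\pm\alpha$, $\alpha(\mathrm{diag}(t,-t))=2t$). The complex crown is $\Xi=G\exp(i\Omega)K_{\mathbb{C}}/K_{\mathbb{C}}\subseteq G_{\mathbb{C}}/K_{\mathbb{C}}$. The "norm" on $G$ is $\|g\|=\mathrm{tr}(gg^t)$ for $g\in G$. Let $Z=\{\pm\mathbf{1}\}$ be the center of $G$ and let $L=N_{K_{\mathbb{C}}}(A_{\mathbb{C}})\times Z=N_K(A)\times Z$, a finite group acting on $A_{\mathbb{C}}$ by $(k,\zeta)\cdot a=kak^{-1}\zeta$. For $x\in K_{\mathbb{C}}A_{\mathbb{C}}K_{\mathbb{C}}$, the element $a\in A_{\mathbb{C}}$ with $x\in K_{\mathbb{C}}aK_{\mathbb{C}}$ is uniquely determined up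 to the action of $L$; its class in $A_{\mathbb{C}}/L$ is denoted $a_{K_{\mathbb{C}}}(x)$. This induces a map $a_{K_{\mathbb{C}}}:\Xi\to A_{\mathbb{C}}/L$ by setting it equal to this class if $x\in\Xi$ lies in $K_{\mathbb{C}}A_{\mathbb{C}}K_{\mathbb{C}}/K_{\mathbb{C}}$, and equal to the class of $\mathbf{1}$ if $x\in\Xi$ does not lie in $K_{\mathbb{C}}A_{\mathbb{C}}K_{\mathbb{C}}/K_{\mathbb{C}}$. The "norm" on $A_{\mathbb{C}}$ is $|\mathrm{diag}(z,z^{-1})|=|z|^2+|z|^{-2}$; it is $L$-invariant and hence factors to a function on $A_{\mathbb{C}}/L$, also denoted $|\cdot|$. *)

theory Defs
  imports "HOL-Analysis.Analysis"
begin

type_synonym rmat = "real^2^2"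
type_synonym cmat = "complex^2^2"

definition diag2 :: "'a::zero \<Rightarrow> 'a \<Rightarrow> 'a^2^2" where
  "diag2 x y = vector [vector [x, 0], vector [0, y]]"

text \<open>\<^const>\<open>exp\<close> does not apply to square matrices, because multiplication and powers of the
  type class on \<open>'a^2^2\<close> are componentwise; hence the exponential series with matrix powers.\<close>

definition mat_exp :: "cmat \<Rightarrow> cmat" where
  "mat_exp X = (\<Sum>n. (1 / fact n) *\<^sub>R (((**) X ^^ n) (mat 1)))"

definition complexify :: "rmat \<Rightarrow> cmat" where
  "complexify = map_matrix complex_of_real"

definition imag_mat :: "rmat \<Rightarrow> cmat" where
  "imag_mat = map_matrix (\<lambda>x. \<i> * complex_of_real x)"

definition SL2R :: "rmat set" where
  "SL2R = {g. det g = 1}"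

definition SL2C :: "cmat set" where
  "SL2C = {g. det g = 1}"

text \<open>\<^const>\<open>rotation_matrix\<close> uses the bilinear transpose, without complex conjugation, so
  over the complex numbers the following is \<open>SO(2,\<complex>)\<close> and not a unitary group.\<close>

definition KC :: "cmat set" where
  "KC = {k. rotation_matrix k}"

definition AC :: "cmat set" where
  "AC = {diag2 z (inverse z) |z. z \<noteq> 0}"

definition Omega :: "rmat set" where
  "Omega = {diag2 t (- t) |t. \<bar>t\<bar> < pi / 4}"

definition coset_KC :: "cmat \<Rightarrow> cmat set" where
  "coset_KC x = {x ** k |k. k \<in> KC}"

text \<open>The complex crown \<open>\<Xi>\<close>, a subset of \<open>coset_KC ` SL2C\<close>, which is \<open>G\<^sub>\<complex> / K\<^sub>\<complex>\<close>.\<close>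

definition crown :: "cmat set set" where
  "crown = {coset_KC (complexify h ** mat_exp (imag_mat X)) |h X. h \<in> SL2R \<and> X \<in> Omega}"

definition double_coset_KC :: "cmat \<Rightarrow> cmat set" where
  "double_coset_KC a = {k ** a ** k' |k k'. k \<in> KC \<and> k' \<in> KC}"

definition normalizer_KC_AC :: "cmat set" where
  "normalizer_KC_AC = {k \<in> KC. (\<lambda>a. k ** a ** matrix_inv k) ` AC = AC}"

definition center :: "cmat set" where
  "center = {mat 1, - mat 1}"

definition L :: "(cmat \<times> cmat) set" where
  "L = normalizer_KC_AC \<times> center"

text \<open>The class of \<open>a\<close> in \<open>A\<^sub>\<complex> / L\<close>, i.e. its orbit under \<open>(k, \<zeta>) \<cdot> a = k a k\<^sup>-\<^sup>1 \<zeta>\<close>.\<close>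

definition L_class :: "cmat \<Rightarrow> cmat set" where
  "L_class a = {k ** a ** matrix_inv k ** \<zeta> |k \<zeta>. (k, \<zeta>) \<in> L}"

text \<open>A point of \<open>G\<^sub>\<complex> / K\<^sub>\<complex>\<close> is a left coset \<open>C\<close>. It lies in \<open>K\<^sub>\<complex> A\<^sub>\<complex> K\<^sub>\<complex> / K\<^sub>\<complex>\<close> iff \<open>C\<close> is
  contained in a double coset \<open>K\<^sub>\<complex> a K\<^sub>\<complex>\<close> with \<open>a\<close> in \<open>A\<^sub>\<complex>\<close>, and \<open>a\<close> is then unique up to \<open>L\<close>.\<close>

definition a_KC :: "cmat set \<Rightarrow> cmat set" where
  "a_KC C =
    (if \<exists>a\<in>AC. C \<subseteq> double_coset_KC a
     then THE c. \<exists>a\<in>AC. C \<subseteq> double_coset_KC a \<and> c = L_class a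
     else L_class (mat 1))"

definition norm_G :: "rmat \<Rightarrow> real" where
  "norm_G g = trace (g ** transpose g)"

definition norm_AC :: "cmat \<Rightarrow> real" where
  "norm_AC a = (cmod (a $ 1 $ 1))\<^sup>2 + inverse ((cmod (a $ 1 $ 1))\<^sup>2)"

text \<open>The function on \<open>A\<^sub>\<complex> / L\<close> through which \<^const>\<open>norm_AC\<close> factors: its common value on an orbit.\<close>

definition norm_AC_L :: "cmat set \<Rightarrow> real" where
  "norm_AC_L c = the_elem (norm_AC ` c)"

end

theory Submission
  imports Defs
begin

text \<open>The matrix \<open>x x\<^sup>t\<close> is conjugated by \<open>K\<^sub>\<complex>\<close> when \<open>x\<close> moves in its double coset, so if \<open>x\<close> lies in
  \<open>K\<^sub>\<complex> diag(z, z\<^sup>-\<^sup>1) K\<^sub>\<complex>\<close> then \<open>w = z\<^sup>2\<close> satisfies \<open>w + 1/w = tr (x x\<^sup>t)\<close>; this determines \<open>z\<close> up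
  to \<open>L\<close>. For \<open>x = h exp(iX)\<close> with \<open>X = diag(t, -t)\<close>, the trace is
  \<open>u = s cos 2t + i d sin 2t\<close>, where \<open>s = \<parallel>h\<parallel>\<close> and \<open>d\<close> are the sum and the difference of the squared
  lengths of the columns of \<open>h\<close>. As \<open>det h = 1\<close>, one has \<open>d\<^sup>2 + 4 \<le> s\<^sup>2\<close>, so \<open>u\<close> lies inside
  the ellipse with foci \<open>\<plusminus>2\<close> and major semi-axis \<open>s\<close>. Hence
  \<open>2 (\<bar>w\<bar> + 1/\<bar>w\<bar>) = \<bar>u - 2\<bar> + \<bar>u + 2\<bar> \<le> 2 s\<close>.\<close>

section \<open>Diagonal two-by-two matrices and their exponential\<close>

lemma diag2_nth [simp]:
  "diag2 x y $ 1 $ 1 = x" "diag2 x y $ 1 $ 2 = 0" "diag2 x y $ 2 $ 1 = 0" "diag2 x y $ 2 $ 2 = y"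
  by (simp_all add: diag2_def)

lemma matrix2_eq_iff:
  fixes A B :: "'a^2^2"
  shows "A = B \<longleftrightarrow> A$1$1 = B$1$1 \<and> A$1$2 = B$1$2 \<and> A$2$1 = B$2$1 \<and> A$2$2 = B$2$2"
  by (auto simp: vec_eq_iff forall_2)

lemma diag2_eq_iff [simp]: "diag2 x y = diag2 x' y' \<longleftrightarrow> x = x' \<and> y = y'"
  by (simp add: matrix2_eq_iff)

lemma matrix_mult2_nth:
  fixes A B :: "'a::semiring_1^2^2"
  shows "(A ** B) $ i $ j = A$i$1 * B$1$j + A$i$2 * B$2$j"
  by (simp add: matrix_matrix_mult_def sum_2)

lemma trace2: "trace (A :: 'a::comm_semiring_1^2^2) = A$1$1 + A$2$2"
  by (simp add: trace_def sum_2)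

lemma diag2_mult [simp]: "diag2 x y ** diag2 x' y' = diag2 (x * x') (y * y' :: 'a::semiring_1)"
  by (simp add: matrix2_eq_iff matrix_mult2_nth)

lemma transpose_diag2 [simp]: "transpose (diag2 x y) = diag2 x y"
  by (simp add: matrix2_eq_iff transpose_def)

lemma mat_1_eq_diag2: "mat 1 = diag2 1 1"
  by (simp add: matrix2_eq_iff mat_def)

lemma minus_diag2 [simp]: "- diag2 x y = diag2 (- x) (- y :: 'a::ring_1)"
  by (simp add: matrix2_eq_iff)

lemma trace_diag2 [simp]: "trace (diag2 x y) = (x + y :: 'a::comm_semiring_1)"
  by (simp add: trace2)

lemma mat_exp_diag2: "mat_exp (diag2 x y) = diag2 (exp x) (exp y)"
proof -
  have pow: "((**) (diag2 x y) ^^ n) (mat 1) = diag2 (x ^ n) (y ^ n)" for n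
    by (induction n) (simp_all add: mat_1_eq_diag2)
  have scale: "r *\<^sub>R diag2 a b = diag2 (r *\<^sub>R a) (r *\<^sub>R b)" for r and a b :: complex
    by (simp add: matrix2_eq_iff)
  have partial: "(\<Sum>n<N. diag2 (f n) (g n)) = diag2 (\<Sum>n<N. f n) (\<Sum>n<N. g n)"
    for f g :: "nat \<Rightarrow> complex" and N
    by (simp add: matrix2_eq_iff)
  have "(\<lambda>n. (1 / fact n) *\<^sub>R (((**) (diag2 x y) ^^ n) (mat 1))) sums diag2 (exp x) (exp y)"
    unfolding pow scale sums_def partial
  proof (rule vec_tendstoI, rule vec_tendstoI)
    have lim: "(\<lambda>N. \<Sum>n<N. (1 / fact n) *\<^sub>R c ^ n) \<longlonglongrightarrow> exp c" for c :: complex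
      using exp_converges[of c] by (simp add: sums_def inverse_eq_divide)
    fix i j :: 2
    show "(\<lambda>N. diag2 (\<Sum>n<N. (1 / fact n) *\<^sub>R x ^ n) (\<Sum>n<N. (1 / fact n) *\<^sub>R y ^ n) $ i $ j)
      \<longlonglongrightarrow> diag2 (exp x) (exp y) $ i $ j"
      using exhaust_2[of i] exhaust_2[of j] lim by auto
  qed
  then show ?thesis
    by (simp add: mat_exp_def sums_iff)
qed

section \<open>Complex rotations and the trace as an invariant of double cosets\<close>

lemma KC_D:
  assumes "k \<in> KC"
  shows "k ** transpose k = mat 1" "transpose k ** k = mat 1"
  using assms by (auto simp: KC_def rotation_matrix_def orthogonal_matrix_def)

lemma mat_1_in_KC: "mat 1 \<in> KC"
  by (simp add: KC_def rotation_matrix_def orthogonal_matrix_def transpose_mat)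

text \<open>\<open>matrix_inv\<close> is a Hilbert choice, so uniqueness of two-sided inverses is
  what pins it down.\<close>

lemma matrix_inv_KC:
  assumes "k \<in> KC"
  shows "matrix_inv k = transpose k"
  unfolding matrix_inv_def
proof (rule some_equality)
  show "k ** transpose k = mat 1 \<and> transpose k ** k = mat 1"
    using KC_D[OF assms] by blast
  show "B = transpose k" if "k ** B = mat 1 \<and> B ** k = mat 1" for B
    by (metis that KC_D(1)[OF assms] matrix_mul_assoc matrix_mul_lid matrix_mul_rid)
qed

lemma trace_conj_KC:
  assumes "k \<in> KC"
  shows "trace (k ** A ** transpose k) = trace A"
  by (metis KC_D(2)[OF assms] trace_mul_sym matrix_mul_assoc matrix_mul_lid)

lemma trace_double_coset_KC:
  assumes "x \<in> double_coset_KC a"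
  shows "trace (x ** transpose x) = trace (a ** transpose a)"
proof -
  obtain k k' where k: "k \<in> KC" "k' \<in> KC" and x: "x = k ** a ** k'"
    using assms by (auto simp: double_coset_KC_def)
  have "x ** transpose x = k ** (a ** (k' ** transpose k') ** transpose a) ** transpose k"
    by (simp add: x matrix_transpose_mul matrix_mul_assoc)
  then show ?thesis
    using k by (simp add: KC_D trace_conj_KC)
qed

section \<open>Orbits of \<open>L\<close> and the class \<open>a_KC\<close>\<close>

lemma add_inverse_eq_iff:
  fixes z w :: "'a::field"
  assumes "z \<noteq> 0" "w \<noteq> 0"
  shows "z + inverse z = w + inverse w \<longleftrightarrow> w = z \<or> w = inverse z"
proof
  assume "z + inverse z = w + inverse w"
  \<comment> \<open>The difference of the two sides, multiplied by \<open>z * w\<close>, factors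
    this way.\<close>
  then have "(w - z) * (w * z - 1) = 0"
    using assms by (simp add: field_simps)
  then have "w = z \<or> w * z = 1"
    by simp
  then show "w = z \<or> w = inverse z"
    using inverse_unique[of z w] by (auto simp: mult.commute)
qed auto

text \<open>\<open>n\<close> represents the nontrivial Weyl group element; it supplies the inversion
  of \<open>z\<close> in the orbit.\<close>

lemma weyl_conj_diag2:
  fixes n :: cmat
  defines "n \<equiv> vector [vector [0, 1], vector [-1, 0]]"
  shows "n \<in> KC" "n ** diag2 x y ** transpose n = diag2 y x"
proof -
  show "n \<in> KC"
    by (simp add: KC_def rotation_matrix_def orthogonal_matrix_def matrix2_eq_iff matrix_mult2_nth
        mat_1_eq_diag2 det_2 transpose_def n_def)
  show "n ** diag2 x y ** transpose n = diag2 y x"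
    by (simp add: matrix2_eq_iff matrix_mult2_nth transpose_def n_def)
qed

text \<open>Conjugation by the normalizer stays in \<open>AC\<close> and preserves the trace
  \<open>z + inverse z\<close>, so it can only fix or invert \<open>z\<close>; the center adds the
  sign. The identity and the Weyl element realize both cases.\<close>

lemma L_class_diag2:
  assumes z: "z \<noteq> 0"
  shows "L_class (diag2 z (inverse z)) =
    {diag2 w (inverse w) |w. w \<in> {z, inverse z, - z, - inverse z}}" (is "?L = ?R")
proof
  show "?L \<subseteq> ?R"
  proof
    fix b assume "b \<in> ?L"
    then obtain k \<zeta> where k: "k \<in> normalizer_KC_AC" and \<zeta>: "\<zeta> = diag2 1 1 \<or> \<zeta> = diag2 (-1) (-1)"
      and b: "b = k ** diag2 z (inverse z) ** matrix_inv k ** \<zeta>"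
      by (auto simp: L_class_def L_def center_def mat_1_eq_diag2)
    have kK: "k \<in> KC"
      using k by (simp add: normalizer_KC_AC_def)
    have "diag2 z (inverse z) \<in> AC"
      using z by (auto simp: AC_def)
    then have "k ** diag2 z (inverse z) ** matrix_inv k \<in> AC"
      using k by (auto simp: normalizer_KC_AC_def)
    then obtain w where w: "w \<noteq> 0" "k ** diag2 z (inverse z) ** matrix_inv k = diag2 w (inverse w)"
      by (auto simp: AC_def)
    then have "z + inverse z = w + inverse w"
      using trace_conj_KC[OF kK, of "diag2 z (inverse z)"] by (simp add: matrix_inv_KC[OF kK])
    then have "w = z \<or> w = inverse z"
      using add_inverse_eq_iff z w(1) by blast
    then show "b \<in> ?R"
      using \<zeta> by (auto simp: b w(2))
  qed
next
  define n :: cmat where "n = vector [vector [0, 1], vector [-1, 0]]"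
  note n = weyl_conj_diag2[folded n_def]
  have "mat 1 \<in> normalizer_KC_AC"
    using matrix_inv_KC[OF mat_1_in_KC]
    by (simp add: normalizer_KC_AC_def mat_1_in_KC transpose_mat)
  moreover have "(\<lambda>a. n ** a ** matrix_inv n) ` AC = AC"
  proof -
    have "(\<lambda>a. n ** a ** matrix_inv n) ` AC = {diag2 (inverse z) z |z. z \<noteq> 0}"
      unfolding AC_def matrix_inv_KC[OF n(1)] setcompr_eq_image image_image n(2) ..
    also have "\<dots> = AC"
      by (auto simp: AC_def)
    finally show ?thesis .
  qed
  ultimately have L: "(k, \<zeta>) \<in> L" if "k \<in> {mat 1, n}" "\<zeta> \<in> {mat 1, - mat 1}" for k \<zeta>
    using that n(1) by (auto simp: L_def center_def normalizer_KC_AC_def)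
  have mem: "k ** diag2 z (inverse z) ** transpose k ** \<zeta> \<in> ?L"
    if "k \<in> {mat 1, n}" "\<zeta> \<in> {mat 1, - mat 1}" for k \<zeta>
  proof -
    have "matrix_inv k = transpose k"
      using that(1) matrix_inv_KC mat_1_in_KC n(1) by auto
    then show ?thesis
      using L[OF that] unfolding L_class_def by force
  qed
  show "?R \<subseteq> ?L"
    using mem[of "mat 1" "mat 1"] mem[of "mat 1" "- mat 1"] mem[of n "mat 1"] mem[of n "- mat 1"]
    by (auto simp: n(2) transpose_mat mat_1_eq_diag2)
qed

text \<open>\<open>norm_AC\<close> is constant on the four orbit members, so \<open>the_elem\<close>
  is meaningful. The value is written in \<open>z\<^sup>2\<close>, the \<open>w\<close> of the focal
  identity.\<close>

lemma norm_AC_L_L_class: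
  assumes "z \<noteq> 0"
  shows "norm_AC_L (L_class (diag2 z (inverse z))) = cmod (z\<^sup>2) + inverse (cmod (z\<^sup>2))"
proof -
  have "norm_AC ` L_class (diag2 z (inverse z)) = {cmod (z\<^sup>2) + inverse (cmod (z\<^sup>2))}"
    unfolding L_class_diag2[OF assms]
    by (force simp: norm_AC_def norm_inverse norm_power power_inverse)
  then show ?thesis
    by (simp add: norm_AC_L_def)
qed

text \<open>The square roots of \<open>z\<^sup>2\<close> and of its inverse are exactly the four
  orbit members. This is the uniqueness behind the \<open>THE\<close> in
  \<open>a_KC\<close>.\<close>

lemma L_class_eq:
  assumes "z \<noteq> 0" "w \<noteq> 0" and "z\<^sup>2 + inverse (z\<^sup>2) = w\<^sup>2 + inverse (w\<^sup>2)"
  shows "L_class (diag2 z (inverse z)) = L_class (diag2 w (inverse w))"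
proof -
  have "w\<^sup>2 = z\<^sup>2 \<or> w\<^sup>2 = (inverse z)\<^sup>2"
    using assms add_inverse_eq_iff[of "z\<^sup>2" "w\<^sup>2"] by (simp add: power_inverse)
  then have "w \<in> {z, inverse z, - z, - inverse z}"
    by (auto simp: power2_eq_iff)
  then show ?thesis
    using assms(1,2) by (auto simp: L_class_diag2)
qed

lemma a_KC_cases:
  obtains "a_KC (coset_KC x) = L_class (mat 1)"
  | z where "z \<noteq> 0" "a_KC (coset_KC x) = L_class (diag2 z (inverse z))"
      "z\<^sup>2 + inverse (z\<^sup>2) = trace (x ** transpose x)"
proof (cases "\<exists>a\<in>AC. coset_KC x \<subseteq> double_coset_KC a")
  case False
  then show ?thesis
    using that(1) by (simp add: a_KC_def)
next
  case True
  \<comment> \<open>As \<open>x\<close> lies in its own coset, any double coset containing the coset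
    has the trace invariant of \<open>x\<close>.\<close>
  have x: "x \<in> coset_KC x"
    using mat_1_in_KC by (force simp: coset_KC_def)
  have tr: "w\<^sup>2 + inverse (w\<^sup>2) = trace (x ** transpose x)"
    if "coset_KC x \<subseteq> double_coset_KC (diag2 w (inverse w))" for w
    using trace_double_coset_KC[of x "diag2 w (inverse w)"] that x
    by (auto simp: power2_eq_square)
  obtain z where z: "z \<noteq> 0" "coset_KC x \<subseteq> double_coset_KC (diag2 z (inverse z))"
    using True by (auto simp: AC_def)
  have "(THE c. \<exists>a\<in>AC. coset_KC x \<subseteq> double_coset_KC a \<and> c = L_class a)
      = L_class (diag2 z (inverse z))"
  proof (rule the_equality)
    show "\<exists>a\<in>AC. coset_KC x \<subseteq> double_coset_KC a \<and> L_class (diag2 z (inverse z)) = L_class a"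
      using z by (auto simp: AC_def)
    fix c assume "\<exists>a\<in>AC. coset_KC x \<subseteq> double_coset_KC a \<and> c = L_class a"
    then obtain w where w: "w \<noteq> 0" "coset_KC x \<subseteq> double_coset_KC (diag2 w (inverse w))"
      and c: "c = L_class (diag2 w (inverse w))"
      by (auto simp: AC_def)
    show "c = L_class (diag2 z (inverse z))"
      unfolding c using z w tr by (intro L_class_eq) auto
  qed
  then have "a_KC (coset_KC x) = L_class (diag2 z (inverse z))"
    using True by (simp add: a_KC_def)
  then show ?thesis
    using that(2) z tr by blast
qed

section \<open>The ellipse with foci 2 and -2\<close>

lemma norm_add_inverse_foci:
  fixes w :: complex
  assumes "w \<noteq> 0"
  shows "2 * (cmod w + inverse (cmod w)) = cmod (w + inverse w - 2) + cmod (w + inverse w + 2)"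
proof -
  \<comment> \<open>The Joukowski map: both focal differences are squares over \<open>w\<close>, so
    the parallelogram law adds their moduli.\<close>
  have "w + inverse w - 2 = (w - 1)\<^sup>2 / w" "w + inverse w + 2 = (w + 1)\<^sup>2 / w"
    using assms by (simp_all add: field_simps power2_eq_square)
  moreover have "(cmod (w - 1))\<^sup>2 + (cmod (w + 1))\<^sup>2 = 2 * ((cmod w)\<^sup>2 + 1)"
    unfolding cmod_power2 by (simp add: power2_eq_square algebra_simps)
  ultimately have "cmod (w + inverse w - 2) + cmod (w + inverse w + 2)
      = 2 * ((cmod w)\<^sup>2 + 1) / cmod w"
    by (simp add: norm_divide norm_power add_divide_distrib [symmetric])
  also have "\<dots> = 2 * (cmod w + inverse (cmod w))"
    using assms by (simp add: field_simps power2_eq_square)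
  finally show ?thesis by simp
qed

lemma ellipse_foci_sum_le:
  fixes s d \<theta> :: real
  assumes s: "0 \<le> s" and sd: "d\<^sup>2 + 4 \<le> s\<^sup>2"
  shows "cmod (Complex (s * cos \<theta>) (d * sin \<theta>) - 2) + cmod (Complex (s * cos \<theta>) (d * sin \<theta>) + 2)
    \<le> 2 * s"
proof -
  have s2: "2 \<le> s"
    using s sd power2_le_imp_le[of 2 s] zero_le_power2[of d] by simp
  \<comment> \<open>Equality holds when \<open>d\<^sup>2 = s\<^sup>2 - 4\<close>, on the ellipse
    itself; a smaller \<open>d\<^sup>2\<close> only shortens the distance. In the sum over both foci
    the cosines cancel.\<close>
  have bound: "cmod (Complex (s * cos \<theta>) (d * sin \<theta>) + of_real c) \<le> s + c * cos \<theta>"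
    if "c = 2 \<or> c = -2" for c
  proof (rule power2_le_imp_le)
    have "d\<^sup>2 * (sin \<theta>)\<^sup>2 \<le> (s\<^sup>2 - 4) * (sin \<theta>)\<^sup>2"
      using sd by (intro mult_right_mono) auto
    then have "d\<^sup>2 * (sin \<theta>)\<^sup>2 \<le> (s\<^sup>2 - 4) * (1 - (cos \<theta>)\<^sup>2)"
      by (simp add: sin_squared_eq)
    then show "(cmod (Complex (s * cos \<theta>) (d * sin \<theta>) + of_real c))\<^sup>2 \<le> (s + c * cos \<theta>)\<^sup>2"
      unfolding cmod_power2 using that by (auto simp: power2_eq_square algebra_simps)
    show "0 \<le> s + c * cos \<theta>"
      using that s2 cos_le_one[of \<theta>] cos_ge_minus_one[of \<theta>] by (elim disjE; hypsubst; linarith)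
  qed
  from bound[of "-2"] bound[of 2] show ?thesis
    by simp
qed

section \<open>The trace at a point of the crown\<close>

lemma SL2R_column_norms:
  fixes h :: rmat
  assumes "h \<in> SL2R"
  defines "A \<equiv> (h$1$1)\<^sup>2 + (h$2$1)\<^sup>2" and "B \<equiv> (h$1$2)\<^sup>2 + (h$2$2)\<^sup>2"
  shows "norm_G h = A + B" "(A - B)\<^sup>2 + 4 \<le> (A + B)\<^sup>2"
proof -
  show "norm_G h = A + B"
    by (simp add: norm_G_def trace2 matrix_mult2_nth transpose_def A_def B_def power2_eq_square)
  have "h$1$1 * h$2$2 - h$1$2 * h$2$1 = 1"
    using assms by (simp add: SL2R_def det_2)
  \<comment> \<open>Lagrange's identity for the two columns. The claim then follows since
    \<open>(A + B)\<^sup>2 - (A - B)\<^sup>2 = 4 * A * B\<close>.\<close>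
  moreover have "A * B = (h$1$1 * h$2$2 - h$1$2 * h$2$1)\<^sup>2 + (h$1$1 * h$1$2 + h$2$1 * h$2$2)\<^sup>2"
    by (simp add: A_def B_def power2_eq_square algebra_simps)
  ultimately have "1 \<le> A * B"
    by simp
  then show "(A - B)\<^sup>2 + 4 \<le> (A + B)\<^sup>2"
    by (simp add: power2_eq_square algebra_simps)
qed

lemma trace_complexify_mult_diag2:
  "trace ((complexify h ** diag2 x y) ** transpose (complexify h ** diag2 x y))
    = of_real ((h$1$1)\<^sup>2 + (h$2$1)\<^sup>2) * x\<^sup>2 + of_real ((h$1$2)\<^sup>2 + (h$2$2)\<^sup>2) * y\<^sup>2"
  by (simp add: trace2 matrix_mult2_nth transpose_def complexify_def map_matrix_def
      power2_eq_square algebra_simps)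

theorem proposition6p1:
  fixes h X :: "real^2^2" and g :: "(complex^2^2) set"
  assumes "g \<in> crown"
    and "h \<in> SL2R" and "X \<in> Omega"
    and "g = coset_KC (complexify h ** mat_exp (imag_mat X))"
  shows "norm_AC_L (a_KC g) \<le> norm_G h"
proof -
  define A where "A = (h$1$1)\<^sup>2 + (h$2$1)\<^sup>2"
  define B where "B = (h$1$2)\<^sup>2 + (h$2$2)\<^sup>2"
  have norm: "norm_G h = A + B" and AB: "(A - B)\<^sup>2 + 4 \<le> (A + B)\<^sup>2"
    using SL2R_column_norms[OF \<open>h \<in> SL2R\<close>] by (simp_all add: A_def B_def)
  have pos: "0 \<le> A + B"
    by (simp add: A_def B_def)
  obtain t where X: "X = diag2 t (- t)"
    using \<open>X \<in> Omega\<close> by (auto simp: Omega_def)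
  define x where "x = complexify h ** diag2 (cis t) (cis (- t))"
  have "imag_mat X = diag2 (\<i> * of_real t) (\<i> * of_real (- t))"
    by (simp add: X imag_mat_def map_matrix_def matrix2_eq_iff)
  then have g: "g = coset_KC x"
    using assms(4) by (simp add: x_def mat_exp_diag2 cis_conv_exp)
  have "trace (x ** transpose x) = of_real A * cis (2 * t) + of_real B * cis (- (2 * t))"
    unfolding x_def trace_complexify_mult_diag2 by (simp add: A_def B_def Complex.DeMoivre)
  also have "\<dots> = Complex ((A + B) * cos (2 * t)) ((A - B) * sin (2 * t))"
    by (simp add: complex_eq_iff algebra_simps)
  finally have tr: "trace (x ** transpose x) = Complex ((A + B) * cos (2 * t)) ((A - B) * sin (2 * t))" .
  show ?thesis
  proof (cases rule: a_KC_cases[of x])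
    \<comment> \<open>The class of the identity, default value included, has norm 2, the least value
      that \<open>norm_G\<close> can take on \<open>SL2R\<close>.\<close>
    case 1
    then have "norm_AC_L (a_KC g) = 2"
      using norm_AC_L_L_class[of 1] by (simp add: g mat_1_eq_diag2)
    moreover have "2 \<le> A + B"
      using AB pos power2_le_imp_le[of 2 "A + B"] zero_le_power2[of "A - B"] by simp
    ultimately show ?thesis
      by (simp add: norm)
  next
    case (2 z)
    then have "2 * norm_AC_L (a_KC g)
        = cmod (trace (x ** transpose x) - 2) + cmod (trace (x ** transpose x) + 2)"
      using norm_add_inverse_foci[of "z\<^sup>2"] by (simp add: g norm_AC_L_L_class)
    also have "\<dots> \<le> 2 * (A + B)"
      unfolding tr by (rule ellipse_foci_sum_le[OF pos AB])
    finally show ?thesis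
      by (simp add: norm)
  qed
qed

end
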